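(* Let $n\ge1$, let $\mathbf{Z}=(Z_1,\ldots,Z_n)\in(\mathbb{D}^{1,1})^n$, and let $\Gamma_{\mathbf{Z}}=\big(\langle DZ_i,DZ_j\rangle_{\mathfrak{H}}\big)_{1\le i,j\le n}$ denote its Malliavin matrix. Then, almost surely, $$\det(\Gamma_{\mathbf{Z}})=\|DZ_1\|_{\mathfrak{H}}^2\prod_{j=2}^n\big\|DZ_j-\mathrm{proj}_{E_{j-1}}(DZ_j)\big\|_{\mathfrak{H}}^2,$$ where $E_{j-1}$ is the linear span in $\mathfrak{H}$ of $\{DZ_1,\ldots,DZ_{j-1}\}$, and $\mathrm{proj}_{E_{j-1}}$ denotes the orthogonal projection onto $E_{j-1}$.
   Context: Let $B=\{B(t),\,t\in\mathbb{R}\}$ be a two-sided standard Brownian motion with $B(0)=0$ on a complete probability space $(\Omega,\mathcal{F},\mathbb{P})$. Let $\mathfrak{H}=L^2(\mathbb{R})$ (real-valued functions), and for $h\in\mathfrak{H}$ let $B(h)=\int_{\mathbb{R}}h(t)\,dB(t)$ be the Wiener integral. Malliavin derivative: for a smooth cylindrical random variable $F=f(B(g_1),\dots,B(g_m))$ with $m\ge1$, $g_i\in\mathfrak{H}$ and $f$ smooth with all derivatives of polynomial growth, $D_rF=\sum_{j=1}^m\frac{\partial f}{\partial x_j}(B(g_1),\dots,B(g_m))\,g_j(r)$, $r\in\mathbb{R}$. The space $\mathbb{D}^{1,1}$ is the closure of the class of smooth cylindrical random variables with respect to the norm $\|F\|_{1,1}=\mathbb{E}[|F|]+\mathbb{E}[\|DF\|_{\mathfrak{H}}]$,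 and $D$ is extended to $\mathbb{D}^{1,1}$ by closure; for $F\in\mathbb{D}^{1,1}$, $DF$ is an $\mathfrak{H}$-valued random variable. The inner product is $\langle DF,DG\rangle_{\mathfrak{H}}=\int_{\mathbb{R}}D_rF\,D_rG\,dr$. The span and the projection are taken $\omega$-wise (so $E_{j-1}$ is a random subspace). *)

theory Defs
  imports "HOL-Probability.Probability" "Jordan_Normal_Form.Determinant"
begin

section \<open>The Hilbert space of square-integrable functions on the real line\<close>

definition square_integrable :: "(real \<Rightarrow> real) \<Rightarrow> bool" where
  "square_integrable f \<longleftrightarrow>
     f \<in> borel_measurable borel \<and> integrable lborel (\<lambda>x. (f x)\<^sup>2)"

definition l2_rel :: "(real \<Rightarrow> real) \<Rightarrow> (real \<Rightarrow> real) \<Rightarrow> bool" where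
  "l2_rel f g \<longleftrightarrow>
     square_integrable f \<and> square_integrable g \<and> (AE x in lborel. f x = g x)"

lemma square_integrable_mult:
  assumes "square_integrable f" "square_integrable g"
  shows "integrable lborel (\<lambda>x. f x * g x)"
proof (rule Bochner_Integration.integrable_bound)
  show "integrable lborel (\<lambda>x. (f x)\<^sup>2 + (g x)\<^sup>2)"
    using assms unfolding square_integrable_def by auto
  show "(\<lambda>x. f x * g x) \<in> borel_measurable lborel"
    using assms unfolding square_integrable_def by auto
  have "\<bar>a * b\<bar> \<le> a\<^sup>2 + b\<^sup>2" for a b :: real
  proof -
    have "0 \<le> (a - b)\<^sup>2" "0 \<le> (a + b)\<^sup>2" "0 \<le> a\<^sup>2" "0 \<le> b\<^sup>2" by simp_all
    then show ?thesis unfolding power2_diff power2_sum by arith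
  qed
  then show "AE x in lborel. norm (f x * g x) \<le> norm ((f x)\<^sup>2 + (g x)\<^sup>2)"
    by simp
qed

lemma square_integrable_add:
  assumes "square_integrable f" "square_integrable g"
  shows "square_integrable (\<lambda>x. f x + g x)"
  using assms square_integrable_mult[OF assms]
  unfolding square_integrable_def by (auto simp: power2_sum mult.assoc)

lemma square_integrable_scale:
  assumes "square_integrable f"
  shows "square_integrable (\<lambda>x. c * f x)"
  using assms unfolding square_integrable_def by (auto simp: power_mult_distrib)

lemma square_integrable_zero: "square_integrable (\<lambda>x. 0)"
  by (simp add: square_integrable_def)

lemma square_integrable_indicator: "square_integrable (indicator {a<..b})"
proof -
  have "(\<lambda>x. (indicator {a<..b} x :: real)\<^sup>2) = indicator {a<..b}"
    by (auto simp: indicator_def)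
  then show ?thesis
    by (cases "a \<le> b") (simp_all add: square_integrable_def)
qed

quotient_type l2 = "real \<Rightarrow> real" / partial: l2_rel
proof (rule part_equivpI)
  show "\<exists>f. l2_rel f f"
    using square_integrable_zero unfolding l2_rel_def by auto
  show "symp l2_rel"
    unfolding l2_rel_def symp_def by auto
  show "transp l2_rel"
    unfolding l2_rel_def transp_def by auto
qed

instantiation l2 :: real_inner
begin

lift_definition zero_l2 :: l2 is "\<lambda>x. 0"
  by (simp add: l2_rel_def square_integrable_zero)

lift_definition plus_l2 :: "l2 \<Rightarrow> l2 \<Rightarrow> l2" is "\<lambda>f g x. f x + g x"
  unfolding l2_rel_def by (auto intro: square_integrable_add)

lift_definition scaleR_l2 :: "real \<Rightarrow> l2 \<Rightarrow> l2" is "\<lambda>c f x. c * f x"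
  unfolding l2_rel_def by (auto intro: square_integrable_scale)

lift_definition uminus_l2 :: "l2 \<Rightarrow> l2" is "\<lambda>f x. - f x"
  unfolding l2_rel_def square_integrable_def by auto

definition minus_l2 :: "l2 \<Rightarrow> l2 \<Rightarrow> l2" where
  "minus_l2 f g = f + (- g)"

lift_definition inner_l2 :: "l2 \<Rightarrow> l2 \<Rightarrow> real" is
  "\<lambda>f g. integral\<^sup>L lborel (\<lambda>x. f x * g x)"
  unfolding l2_rel_def square_integrable_def by (auto intro!: integral_cong_AE)

definition norm_l2 :: "l2 \<Rightarrow> real" where
  "norm_l2 f = sqrt (inner f f)"

definition sgn_l2 :: "l2 \<Rightarrow> l2" where
  "sgn_l2 f = inverse (norm f) *\<^sub>R f"

definition dist_l2 :: "l2 \<Rightarrow> l2 \<Rightarrow> real" where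
  "dist_l2 f g = norm (f - g)"

definition uniformity_l2 :: "(l2 \<times> l2) filter" where
  "uniformity_l2 = (INF e\<in>{0<..}. principal {(f, g). dist f g < e})"

definition open_l2 :: "l2 set \<Rightarrow> bool" where
  "open_l2 U \<longleftrightarrow> (\<forall>x\<in>U. eventually (\<lambda>(x', y). x' = x \<longrightarrow> y \<in> U) uniformity)"

instance
proof
  fix f g h :: l2 and a b :: real and U :: "l2 set"
  show "f + g + h = f + (g + h)"
    by transfer (auto simp: l2_rel_def add.assoc intro!: square_integrable_add)
  show "f + g = g + f"
    by transfer (auto simp: l2_rel_def add.commute intro!: square_integrable_add)
  show "0 + f = f"
    by transfer (auto simp: l2_rel_def)
  show "- f + f = 0"
    by transfer (auto simp: l2_rel_def square_integrable_zero)
  show "f - g = f + - g" by (rule minus_l2_def)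
  show "a *\<^sub>R (f + g) = a *\<^sub>R f + a *\<^sub>R g"
    by transfer (auto simp: l2_rel_def distrib_left
        intro!: square_integrable_add square_integrable_scale)
  show "(a + b) *\<^sub>R f = a *\<^sub>R f + b *\<^sub>R f"
    by transfer (auto simp: l2_rel_def distrib_right
        intro!: square_integrable_add square_integrable_scale)
  show "a *\<^sub>R b *\<^sub>R f = (a * b) *\<^sub>R f"
    by transfer (auto simp: l2_rel_def mult.assoc intro!: square_integrable_scale)
  show "1 *\<^sub>R f = f"
    by transfer (auto simp: l2_rel_def)
  show "dist f g = norm (f - g)" by (rule dist_l2_def)
  show "sgn f = inverse (norm f) *\<^sub>R f" by (rule sgn_l2_def)
  show "uniformity = (INF e\<in>{0<..}. principal {(f :: l2, g). dist f g < e})"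
    by (rule uniformity_l2_def)
  show "open U = (\<forall>x\<in>U. \<forall>\<^sub>F (x', y) in uniformity. x' = x \<longrightarrow> y \<in> U)"
    by (rule open_l2_def)
  show "inner f g = inner g f"
    by transfer (simp add: mult.commute)
  show "inner (f + g) h = inner f h + inner g h"
    by transfer (auto simp: l2_rel_def distrib_right square_integrable_mult)
  show "inner (a *\<^sub>R f) g = a * inner f g"
    by transfer (auto simp: mult.assoc)
  show "0 \<le> inner f f"
    by transfer auto
  show "inner f f = 0 \<longleftrightarrow> f = 0"
  proof transfer
    fix f assume "l2_rel f f"
    then have f: "square_integrable f" by (simp add: l2_rel_def)
    show "integral\<^sup>L lborel (\<lambda>x. f x * f x) = 0 \<longleftrightarrow> l2_rel f (\<lambda>x. 0)"
      using integral_nonneg_eq_0_iff_AE[OF square_integrable_mult[OF f f]]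
      by (auto simp: l2_rel_def f square_integrable_zero)
  qed
  show "norm f = sqrt (inner f f)" by (rule norm_l2_def)
qed

end

lift_definition l2_interval :: "real \<Rightarrow> real \<Rightarrow> l2" is "\<lambda>a b. indicator {a<..b}"
  by (simp add: l2_rel_def square_integrable_indicator)


section \<open>Brownian motion and the Wiener integral\<close>

locale two_sided_brownian_motion = prob_space M for M :: "'w measure" +
  fixes B :: "real \<Rightarrow> 'w \<Rightarrow> real"
  assumes measurable: "B t \<in> borel_measurable M"
    and start: "AE \<omega> in M. B 0 \<omega> = 0"
    and continuous_paths: "AE \<omega> in M. continuous_on UNIV (\<lambda>t. B t \<omega>)"
    and gaussian_increments: "s < t \<Longrightarrow>
      distributed M lborel (\<lambda>\<omega>. B t \<omega> - B s \<omega>) (normal_density 0 (sqrt (t - s)))"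
    and independent_increments: "strict_mono_on {..k} \<tau> \<Longrightarrow>
      indep_vars (\<lambda>_. borel) (\<lambda>i \<omega>. B (\<tau> (Suc i)) \<omega> - B (\<tau> i) \<omega>) {..<k::nat}"

text \<open>The Wiener integral extends
  \<open>\<Sum>\<^sub>i c\<^sub>i 1\<^bsub>(a\<^sub>i, b\<^sub>i]\<^esub> \<mapsto> \<Sum>\<^sub>i c\<^sub>i (B(b\<^sub>i) - B(a\<^sub>i))\<close> from step functions to all of
  \<open>L\<^sup>2\<close> by mean-square limits.  It is determined almost surely only, so it is given as a
  relation that holds for every version \<open>X\<close> of the integral of \<open>h\<close>.\<close>

definition has_step_integral ::
    "(real \<Rightarrow> 'w \<Rightarrow> real) \<Rightarrow> l2 \<Rightarrow> ('w \<Rightarrow> real) \<Rightarrow> bool" where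
  "has_step_integral B h X \<longleftrightarrow>
     (\<exists>(N::nat) c a b. (\<forall>i<N. a i \<le> b i) \<and>
        h = (\<Sum>i<N. c i *\<^sub>R l2_interval (a i) (b i)) \<and>
        X = (\<lambda>\<omega>. \<Sum>i<N. c i * (B (b i) \<omega> - B (a i) \<omega>)))"

definition has_wiener_integral ::
    "'w measure \<Rightarrow> (real \<Rightarrow> 'w \<Rightarrow> real) \<Rightarrow> l2 \<Rightarrow> ('w \<Rightarrow> real) \<Rightarrow> bool" where
  "has_wiener_integral M B h X \<longleftrightarrow>
     X \<in> borel_measurable M \<and>
     (\<exists>hs Xs. (\<forall>k. has_step_integral B (hs k) (Xs k)) \<and>
        hs \<longlonglongrightarrow> h \<and>
        (\<lambda>k. \<integral>\<^sup>+\<omega>. ennreal ((Xs k \<omega> - X \<omega>)\<^sup>2) \<partial>M) \<longlonglongrightarrow> 0)"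


section \<open>Smooth functions of polynomial growth\<close>

text \<open>A function on \<open>\<real>\<^sup>m\<close>, with \<open>m\<close> a natural number that is quantified over below, is a
  function on sequences that depends on the coordinates \<open>0, \<dots>, m - 1\<close> only.  For such a function,
  continuity in the product topology on sequences is continuity on \<open>\<real>\<^sup>m\<close>.\<close>

definition partial_deriv :: "nat \<Rightarrow> ((nat \<Rightarrow> real) \<Rightarrow> real) \<Rightarrow> (nat \<Rightarrow> real) \<Rightarrow> real" where
  "partial_deriv i f x = deriv (\<lambda>t. f (x(i := t))) (x i)"

definition smooth_polynomial_growth :: "nat \<Rightarrow> ((nat \<Rightarrow> real) \<Rightarrow> real) \<Rightarrow> bool" where
  "smooth_polynomial_growth m f \<longleftrightarrow>
     (\<forall>x y. (\<forall>i<m. x i = y i) \<longrightarrow> f x = f y) \<and>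
     (\<forall>is. set is \<subseteq> {..<m} \<longrightarrow>
        continuous_on UNIV (fold partial_deriv is f) \<and>
        (\<forall>i<m. \<forall>x. (\<lambda>t. fold partial_deriv is f (x(i := t))) differentiable at (x i)) \<and>
        (\<exists>C (p::nat). \<forall>x. \<bar>fold partial_deriv is f x\<bar> \<le> C * (1 + (\<Sum>i<m. \<bar>x i\<bar>)) ^ p))"


section \<open>The Malliavin derivative\<close>

definition cylindrical_derivative ::
    "'w measure \<Rightarrow> (real \<Rightarrow> 'w \<Rightarrow> real) \<Rightarrow> ('w \<Rightarrow> real) \<Rightarrow> ('w \<Rightarrow> l2) \<Rightarrow> bool" where
  "cylindrical_derivative M B F DF \<longleftrightarrow>
     (\<exists>m\<ge>1. \<exists>f g X. smooth_polynomial_growth m f \<and>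
        (\<forall>j<m. has_wiener_integral M B (g j) (X j)) \<and>
        (\<forall>\<omega>\<in>space M. F \<omega> = f (\<lambda>j. X j \<omega>)) \<and>
        (\<forall>\<omega>\<in>space M. DF \<omega> = (\<Sum>j<m. partial_deriv j f (\<lambda>j. X j \<omega>) *\<^sub>R g j)))"

text \<open>The closure of the derivative of smooth cylindrical random variables in the norm
  \<open>E\<bar>F\<bar> + E\<parallel>DF\<parallel>\<close>, again as a relation that holds for every version of the derivative.\<close>

definition has_malliavin_derivative ::
    "'w measure \<Rightarrow> (real \<Rightarrow> 'w \<Rightarrow> real) \<Rightarrow> ('w \<Rightarrow> real) \<Rightarrow> ('w \<Rightarrow> l2) \<Rightarrow> bool" where
  "has_malliavin_derivative M B F DF \<longleftrightarrow>
     F \<in> borel_measurable M \<and> DF \<in> borel_measurable M \<and>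
     (\<exists>Fs DFs. (\<forall>k. cylindrical_derivative M B (Fs k) (DFs k)) \<and>
        (\<lambda>k. (\<integral>\<^sup>+\<omega>. ennreal \<bar>Fs k \<omega> - F \<omega>\<bar> \<partial>M) +
             (\<integral>\<^sup>+\<omega>. ennreal (norm (DFs k \<omega> - DF \<omega>)) \<partial>M)) \<longlonglongrightarrow> 0)"

definition D11 :: "'w measure \<Rightarrow> (real \<Rightarrow> 'w \<Rightarrow> real) \<Rightarrow> ('w \<Rightarrow> real) set" where
  "D11 M B = {F. \<exists>DF. has_malliavin_derivative M B F DF}"

text \<open>Matrix indices start at \<open>0\<close>, the components of a random vector are numbered from \<open>1\<close>.\<close>

definition malliavin_matrix :: "nat \<Rightarrow> (nat \<Rightarrow> 'w \<Rightarrow> l2) \<Rightarrow> 'w \<Rightarrow> real mat" where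
  "malliavin_matrix n DZ \<omega> =
     Matrix.mat n n (\<lambda>(i, j). inner (DZ (Suc i) \<omega>) (DZ (Suc j) \<omega>))"

definition orthogonal_proj :: "'a::real_inner set \<Rightarrow> 'a \<Rightarrow> 'a" where
  "orthogonal_proj E x = (THE p. p \<in> E \<and> (\<forall>e\<in>E. inner (x - p) e = 0))"

end

theory Submission
  imports Defs
begin

text \<open>
  The identity is pathwise: for every \<open>\<omega>\<close> the matrix \<open>\<Gamma>\<close> is the Gram matrix \<open>G\<close> of finitely many
  vectors \<open>v\<^sub>0, \<dots>, v\<^bsub>n-1\<^esub>\<close> of a real inner product space, and the right-hand side is the product of
  the squared lengths of the Gram--Schmidt residuals
  \<open>w\<^sub>j = v\<^sub>j - proj\<^bsub>span {v\<^sub>0, \<dots>, v\<^bsub>j-1\<^esub>}\<^esub> v\<^sub>j\<close>.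

  Each \<open>w\<^sub>j\<close> is \<open>v\<^sub>j\<close> minus a combination of the earlier vectors.  Writing this as
  \<open>w\<^sub>i = \<Sum>\<^sub>k L\<^sub>i\<^sub>k v\<^sub>k\<close> gives a lower triangular matrix \<open>L\<close> with unit diagonal, so that \<open>det L = 1\<close>, and
  \<open>(L G)\<^sub>i\<^sub>j = \<langle>w\<^sub>i, v\<^sub>j\<rangle>\<close>.  As \<open>w\<^sub>i\<close> is orthogonal to all earlier vectors, \<open>L G\<close> is upper triangular; and
  as it is orthogonal to \<open>v\<^sub>i - w\<^sub>i\<close>, its diagonal entries are \<open>\<langle>w\<^sub>i, v\<^sub>i\<rangle> = \<parallel>w\<^sub>i\<parallel>\<^sup>2\<close>.  Hence
  \<open>det G = det (L G) = \<Prod>\<^sub>i \<parallel>w\<^sub>i\<parallel>\<^sup>2\<close>.  If the vectors are dependent, then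
  \<open>L\<close> depends on a choice of coefficients, and both sides are zero because some \<open>w\<^sub>i\<close> vanishes.

  The projection is a definite description, so the argument also needs that the projection onto a
  finite-dimensional subspace exists and is unique, even though the ambient space
  need not be complete.
\<close>

text \<open>With respect to an orthogonal generating set \<open>C\<close> the projection is the Fourier sum
  \<open>\<Sum>c\<in>C. (\<langle>x, c\<rangle> / \<langle>c, c\<rangle>) c\<close>.  A zero vector in \<open>C\<close> is harmless, since division by zero yields zero.\<close>

lemma ex_orthogonal_proj_span_finite:
  fixes S :: "'a::real_inner set"
  assumes "finite S"
  shows "\<exists>p\<in>span S. \<forall>e\<in>span S. inner (x - p) e = 0"
proof -
  obtain C where C: "finite C" "span C = span S" "pairwise Linear_Algebra.orthogonal C"
    using basis_orthogonal[OF assms] by blast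
  define p where "p = (\<Sum>c\<in>C. (inner x c / inner c c) *\<^sub>R c)"
  have "p \<in> span C"
    unfolding p_def by (intro span_sum span_scale span_base)
  moreover have "inner (x - p) c = 0" if "c \<in> C" for c
  proof -
    have "inner p c = (\<Sum>d\<in>C. (inner x d / inner d d) * inner d c)"
      by (simp add: p_def inner_sum_left)
    also have "\<dots> = (\<Sum>d\<in>C. if d = c then inner x c else 0)"
      using C(3) that
      by (intro sum.cong) (auto simp: pairwise_def Linear_Algebra.orthogonal_def)
    also have "\<dots> = inner x c"
      using C(1) that by simp
    finally show ?thesis by (simp add: inner_diff_left)
  qed
  then have "\<forall>e\<in>span C. inner (x - p) e = 0"
    using orthogonal_to_span[of _ C "x - p"] by (auto simp: Linear_Algebra.orthogonal_def)
  ultimately show ?thesis using C(2) by auto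
qed

lemma orthogonal_proj_span_finite:
  fixes S :: "'a::real_inner set"
  assumes "finite S"
  shows orthogonal_proj_in_span: "orthogonal_proj (span S) x \<in> span S"
    and inner_diff_orthogonal_proj:
      "e \<in> span S \<Longrightarrow> inner (x - orthogonal_proj (span S) x) e = 0"
proof -
  let ?P = "\<lambda>p. p \<in> span S \<and> (\<forall>e\<in>span S. inner (x - p) e = 0)"
  have "p = q" if p: "?P p" and q: "?P q" for p q
  proof -
    have "p - q \<in> span S" using p q by (simp add: span_diff)
    then have "inner (x - q) (p - q) - inner (x - p) (p - q) = 0" using p q by simp
    then have "inner (p - q) (p - q) = 0" by (simp add: inner_diff_left)
    then show ?thesis by simp
  qed
  then have "\<exists>!p. ?P p"
    using ex_orthogonal_proj_span_finite[OF assms, of x] by blast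
  then have "?P (orthogonal_proj (span S) x)"
    unfolding orthogonal_proj_def by (rule theI')
  then show "orthogonal_proj (span S) x \<in> span S"
    and "e \<in> span S \<Longrightarrow> inner (x - orthogonal_proj (span S) x) e = 0"
    by auto
qed

text \<open>The coefficients are attached to the indices and not to the vectors, because the
  family may have repetitions.\<close>

lemma in_span_image_lessThanE:
  fixes v :: "nat \<Rightarrow> 'a::real_vector"
  assumes "x \<in> span (v ` {..<m})"
  obtains a where "x = (\<Sum>k<m. a k *\<^sub>R v k)"
proof -
  have "\<exists>a. x = (\<Sum>k<m. a k *\<^sub>R v k)" using assms
  proof (induction m arbitrary: x)
    case (Suc m)
    then obtain c where "x - c *\<^sub>R v m \<in> span (v ` {..<m})"
      by (auto simp: lessThan_Suc span_breakdown_eq)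
    then obtain a where "x - c *\<^sub>R v m = (\<Sum>k<m. a k *\<^sub>R v k)"
      using Suc.IH by blast
    then have "x = (\<Sum>k<Suc m. (a(m := c)) k *\<^sub>R v k)"
      by (simp add: algebra_simps)
    then show ?case by blast
  qed simp
  then show ?thesis using that by blast
qed

theorem det_Gram_matrix:
  fixes v :: "nat \<Rightarrow> 'a::real_inner"
  shows "Determinant.det (Matrix.mat n n (\<lambda>(i, j). inner (v i) (v j))) =
    (\<Prod>j<n. (norm (v j - orthogonal_proj (span (v ` {..<j})) (v j)))\<^sup>2)"
proof -
  define p where "p j = orthogonal_proj (span (v ` {..<j})) (v j)" for j
  define w where "w j = v j - p j" for j
  have p_span: "p j \<in> span (v ` {..<j})" for j
    unfolding p_def by (rule orthogonal_proj_in_span) simp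
  have w_orth: "inner (w j) e = 0" if "e \<in> span (v ` {..<j})" for j e
    unfolding w_def p_def using that by (intro inner_diff_orthogonal_proj) simp_all
  have "\<exists>a. p j = (\<Sum>k<j. a k *\<^sub>R v k)" for j
    using in_span_image_lessThanE[OF p_span[of j]] by blast
  then obtain a where a: "p j = (\<Sum>k<j. a j k *\<^sub>R v k)" for j
    by metis

  define l where "l i k = (if k < i then - a i k else if k = i then 1 else 0)" for i k
  have w_l: "w i = (\<Sum>k<n. l i k *\<^sub>R v k)" if "i < n" for i
  proof -
    have "(\<Sum>k<n. l i k *\<^sub>R v k) = (\<Sum>k<Suc i. l i k *\<^sub>R v k)"
      using that by (intro sum.mono_neutral_right) (auto simp: l_def)
    also have "\<dots> = w i"
      by (simp add: l_def w_def a sum_negf)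
    finally show ?thesis by simp
  qed

  define G where "G = Matrix.mat n n (\<lambda>(i, j). inner (v i) (v j))"
  define L where "L = Matrix.mat n n (\<lambda>(i, j). l i j)"
  have G: "G \<in> carrier_mat n n" and L: "L \<in> carrier_mat n n"
    by (simp_all add: G_def L_def)
  have LG: "(L * G) $$ (i, j) = inner (w i) (v j)" if "i < n" "j < n" for i j
    using that
    by (simp add: L_def G_def scalar_prod_def w_l inner_sum_left atLeast0LessThan)
  have LG_diag: "(L * G) $$ (i, i) = (norm (w i))\<^sup>2" if "i < n" for i
  proof -
    have "inner (w i) (v i) = inner (w i) (w i) + inner (w i) (p i)"
      by (simp add: w_def flip: inner_add_right)
    then show ?thesis
      using that by (simp add: LG w_orth p_span power2_norm_eq_inner)
  qed

  have "Determinant.det L = prod_list (diag_mat L)"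
    using L by (intro det_lower_triangular[where n = n]) (auto simp: L_def l_def)
  also have "\<dots> = 1"
    by (simp add: prod_list_diag_prod L_def l_def)
  finally have "Determinant.det G = Determinant.det (L * G)"
    using det_mult[OF L G] by simp
  also have "\<dots> = prod_list (diag_mat (L * G))"
  proof (rule det_upper_triangular)
    show "L * G \<in> carrier_mat n n" using L G by simp
    have "(L * G) $$ (i, j) = 0" if "i < n" "j < i" for i j
    proof -
      have "v j \<in> span (v ` {..<i})" using \<open>j < i\<close> by (intro span_base) simp
      then show ?thesis using that by (simp add: LG w_orth)
    qed
    then show "upper_triangular (L * G)"
      using L by (auto simp: upper_triangular_def)
  qed
  also have "\<dots> = (\<Prod>i<n. (L * G) $$ (i, i))"
    using L by (simp add: prod_list_diag_prod atLeast0LessThan)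
  also have "\<dots> = (\<Prod>i<n. (norm (w i))\<^sup>2)"
    by (intro prod.cong) (simp_all add: LG_diag)
  finally show ?thesis by (simp add: G_def w_def p_def)
qed

theorem lemma4p1:
  fixes M :: "'w measure" and B :: "real \<Rightarrow> 'w \<Rightarrow> real"
    and n :: nat and Z :: "nat \<Rightarrow> 'w \<Rightarrow> real" and DZ :: "nat \<Rightarrow> 'w \<Rightarrow> l2"
  assumes "complete_measure M" and "two_sided_brownian_motion M B"
    and "n \<ge> 1"
    and "\<And>i. i \<in> {1..n} \<Longrightarrow> Z i \<in> D11 M B"
    and "\<And>i. i \<in> {1..n} \<Longrightarrow> has_malliavin_derivative M B (Z i) (DZ i)"
  shows "AE \<omega> in M. Determinant.det (malliavin_matrix n DZ \<omega>) =
    (norm (DZ 1 \<omega>))\<^sup>2 *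
    (\<Prod>j = 2..n. (norm (DZ j \<omega> -
       orthogonal_proj (span ((\<lambda>i. DZ i \<omega>) ` {1..j - 1})) (DZ j \<omega>)))\<^sup>2)"
proof (rule AE_I2)
  fix \<omega>
  let ?r = "\<lambda>j. (norm (DZ j \<omega> -
       orthogonal_proj (span ((\<lambda>i. DZ i \<omega>) ` {1..j - 1})) (DZ j \<omega>)))\<^sup>2"
  have shift: "(\<lambda>i. DZ (Suc i) \<omega>) ` {..<j} = (\<lambda>i. DZ i \<omega>) ` {1..j}" for j
    using image_image[of "\<lambda>i. DZ i \<omega>" Suc "{..<j}"] by (simp add: image_Suc_lessThan)
  have "Determinant.det (malliavin_matrix n DZ \<omega>) = (\<Prod>j<n. ?r (Suc j))"
    unfolding malliavin_matrix_def
    by (subst det_Gram_matrix[where v = "\<lambda>i. DZ (Suc i) \<omega>"]) (simp add: shift)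
  also have "\<dots> = (\<Prod>j = 1..n. ?r j)"
    using prod.reindex[of Suc "{..<n}" ?r] by (simp add: image_Suc_lessThan)
  also have "\<dots> = ?r 1 * (\<Prod>j = 2..n. ?r j)"
    using \<open>n \<ge> 1\<close> prod.atLeast_Suc_atMost[of 1 n ?r] by (simp add: numeral_2_eq_2)
  \<comment> \<open>The first factor has the form of the others, with the projection onto the span of the empty set.\<close>
  also have "?r 1 = (norm (DZ 1 \<omega>))\<^sup>2"
    using orthogonal_proj_in_span[of "{}" "DZ 1 \<omega>"] by simp
  finally show "Determinant.det (malliavin_matrix n DZ \<omega>) =
      (norm (DZ 1 \<omega>))\<^sup>2 * (\<Prod>j = 2..n. ?r j)" .
qed

end
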